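(* Let $\hbar>0$ and let $\theta_x,\theta_p\in[0,1]$ with $\theta_x+\theta_p\le 1$. Then for every $\varepsilon>0$ there exists a unit vector $\psi\in L^2(\mathbb{R})$ such that simultaneously $$\Delta^{c}x(\theta_x,\psi)<\varepsilon\qquad\text{and}\qquad \Delta^{c}p(\theta_p,\psi)<\varepsilon .$$ Equivalently, the largest constant $g\ge 0$, independent of $\psi$, such that $\Delta^{c}x(\theta_x,\psi)\cdot\Delta^{c}p(\theta_p,\psi)\ge g\,\hbar$ for all unit vectors $\psi\in L^2(\mathbb{R})$ is $g=0$. In particular, this holds for $\theta_x=\theta_p=\tfrac12$.
   Context: A (pure) quantum state is a unit vector $\psi\in L^2(\mathbb{R})$ (complex-valued). Its momentum wave function is $\hat\psi(p)=\frac{1}{\sqrt{2\pi\hbar}}\int_{\mathbb{R}} e^{-ipx/\hbar}\psi(x)\,dx$ (the unitary Fourier transform on $L^2(\mathbb{R})$), where $\hbar>0$ is a fixed constant. Let $\mu$ denote Lebesgue measure on $\mathbb{R}$. Confidence uncertainty of position at level $\theta_x\in[0,1]$: $$\Delta^{c}x(\theta_x,\psi)=\inf\Big\{\mu(X): X\subseteq\mathbb{R}\text{ Lebesgue measurable},\ \int_X|\psi(x)|^2\,dx\ge\theta_x\Big\}.$$ Confidence uncertainty of momentum at level $\theta_p\in[0,1]$: $$\Delta^{c}p(\theta_p,\psi)=\inf\Big\{\mu(Y): Y\subseteq\mathbb{R}\text{ Lebesgue measurable},\ \int_Y|\hat\psi(p)|^2\,dp\ge\theta_p\Big\}.$$ Both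 take values in $[0,+\infty]$. *)

theory Defs
  imports "HOL-Analysis.Analysis"
begin

text \<open>Elements of \<open>L\<^sup>2(\<real>)\<close> are represented by functions rather than by almost-everywhere
  classes.\<close>

definition square_integrable :: "(real \<Rightarrow> complex) \<Rightarrow> bool" where
  "square_integrable f \<longleftrightarrow>
     f \<in> borel_measurable lebesgue \<and> integrable lebesgue (\<lambda>x. (cmod (f x))\<^sup>2)"

definition pure_state :: "(real \<Rightarrow> complex) \<Rightarrow> bool" where
  "pure_state \<psi> \<longleftrightarrow> square_integrable \<psi> \<and> (LINT x|lebesgue. (cmod (\<psi> x))\<^sup>2) = 1"

definition truncated_fourier :: "real \<Rightarrow> real \<Rightarrow> (real \<Rightarrow> complex) \<Rightarrow> real \<Rightarrow> complex" where
  "truncated_fourier hbar R \<psi> p =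
     complex_of_real (1 / sqrt (2 * pi * hbar)) *
     (LINT x:{-R..R}|lebesgue. exp (- (\<i> * complex_of_real (p * x / hbar))) * \<psi> x)"

text \<open>The integral defining the Fourier transform need not converge absolutely for
  \<open>\<psi> \<in> L\<^sup>2(\<real>)\<close>; as usual it is understood as the limit in \<open>L\<^sup>2\<close> of the integrals over
  \<open>[-R, R]\<close>. The distance is a nonnegative (extended) integral because the Bochner
  integral would be \<open>0\<close> for a difference that is not square integrable.\<close>

definition is_momentum_wave :: "real \<Rightarrow> (real \<Rightarrow> complex) \<Rightarrow> (real \<Rightarrow> complex) \<Rightarrow> bool" where
  "is_momentum_wave hbar \<psi> \<phi> \<longleftrightarrow> square_integrable \<phi> \<and>
     ((\<lambda>R. \<integral>\<^sup>+ p. ennreal ((cmod (\<phi> p - truncated_fourier hbar R \<psi> p))\<^sup>2) \<partial>lebesgue)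
        \<longlongrightarrow> 0) at_top"

text \<open>By Plancherel's theorem every square integrable \<open>\<psi>\<close> has such a \<open>\<phi>\<close> when \<open>hbar > 0\<close>. It is
  unique almost everywhere (\<open>is_momentum_wave_AE_unique\<close> below), so the choice of a
  representative does not affect integrals of \<open>\<bar>\<phi>\<bar>\<^sup>2\<close>.\<close>

definition momentum_wave :: "real \<Rightarrow> (real \<Rightarrow> complex) \<Rightarrow> real \<Rightarrow> complex" where
  "momentum_wave hbar \<psi> = (SOME \<phi>. is_momentum_wave hbar \<psi> \<phi>)"

definition confidence_width :: "real \<Rightarrow> (real \<Rightarrow> complex) \<Rightarrow> ennreal" where
  "confidence_width \<theta> f =
     Inf {emeasure lebesgue X | X. X \<in> sets lebesgue \<and> (LINT x:X|lebesgue. (cmod (f x))\<^sup>2) \<ge> \<theta>}"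

definition position_uncertainty :: "real \<Rightarrow> (real \<Rightarrow> complex) \<Rightarrow> ennreal" where
  "position_uncertainty \<theta> \<psi> = confidence_width \<theta> \<psi>"

definition momentum_uncertainty :: "real \<Rightarrow> real \<Rightarrow> (real \<Rightarrow> complex) \<Rightarrow> ennreal" where
  "momentum_uncertainty hbar \<theta> \<psi> = confidence_width \<theta> (momentum_wave hbar \<psi>)"

text \<open>In the product below, \<open>0 * \<infinity> = 0\<close>.\<close>

definition uncertainty_constants :: "real \<Rightarrow> real \<Rightarrow> real \<Rightarrow> real set" where
  "uncertainty_constants hbar \<theta>\<^sub>x \<theta>\<^sub>p =
     {g. g \<ge> 0 \<and> (\<forall>\<psi>. pure_state \<psi> \<longrightarrow>
        position_uncertainty \<theta>\<^sub>x \<psi> * momentum_uncertainty hbar \<theta>\<^sub>p \<psi> \<ge> ennreal (g * hbar))}"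

lemma borel_measurable_truncated_fourier:
  assumes "\<psi> \<in> borel_measurable lebesgue"
  shows "truncated_fourier hbar R \<psi> \<in> borel_measurable lebesgue"
proof -
  have fst': "fst \<in> borel_measurable (lebesgue \<Otimes>\<^sub>M (lebesgue :: real measure))"
    and snd': "snd \<in> borel_measurable ((lebesgue :: real measure) \<Otimes>\<^sub>M lebesgue)"
    using measurable_compose[OF measurable_fst, of "\<lambda>x. x" lebesgue borel lebesgue]
      measurable_compose[OF measurable_snd, of "\<lambda>x. x" lebesgue borel lebesgue]
    by (simp_all add: measurable_completion)
  have [measurable]: "(\<lambda>z. \<psi> (snd z)) \<in> borel_measurable ((lebesgue :: real measure) \<Otimes>\<^sub>M lebesgue)"
    by (rule measurable_compose[OF measurable_snd assms])
  have [measurable]: "(\<lambda>z. indicat_real {-R..R} (snd z)) \<in> borel_measurable ((lebesgue :: real measure) \<Otimes>\<^sub>M lebesgue)"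
    by (rule measurable_compose[OF snd']) simp
  have [measurable]: "(\<lambda>z. exp (- (\<i> * complex_of_real (fst z * snd z / hbar))))
      \<in> borel_measurable ((lebesgue :: real measure) \<Otimes>\<^sub>M lebesgue)"
    using fst' snd' by measurable
  have "sigma_finite_measure (lebesgue :: real measure)"
  proof
    show "\<exists>A. countable A \<and> A \<subseteq> sets lebesgue \<and> \<Union>A = space lebesgue \<and>
        (\<forall>a\<in>A. emeasure (lebesgue :: real measure) a \<noteq> \<infinity>)"
    proof (intro exI conjI)
      show "\<Union>(range (\<lambda>n::nat. {- real n .. real n})) = space lebesgue"
      proof -
        have "\<exists>n::nat. - real n \<le> x \<and> x \<le> real n" for x :: real
          using real_arch_simple[of "\<bar>x\<bar>"] by (auto simp: abs_le_iff minus_le_iff)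
        then show ?thesis by auto
      qed
    qed auto
  qed
  then interpret sigma_finite_measure "lebesgue :: real measure" .
  show ?thesis
    unfolding truncated_fourier_def set_lebesgue_integral_def
    by (intro borel_measurable_times borel_measurable_const borel_measurable_lebesgue_integral)
       (simp only: case_prod_beta', measurable)
qed

lemma is_momentum_wave_AE_unique:
  assumes "\<psi> \<in> borel_measurable lebesgue"
    and "is_momentum_wave hbar \<psi> \<phi>\<^sub>1" and "is_momentum_wave hbar \<psi> \<phi>\<^sub>2"
  shows "AE p in lebesgue. \<phi>\<^sub>1 p = \<phi>\<^sub>2 p"
proof -
  define F where "F R = truncated_fourier hbar R \<psi>" for R
  define D where "D \<phi> R = (\<integral>\<^sup>+ p. ennreal ((cmod (\<phi> p - F R p))\<^sup>2) \<partial>lebesgue)" for \<phi> R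
  have [measurable]: "\<phi>\<^sub>1 \<in> borel_measurable lebesgue" "\<phi>\<^sub>2 \<in> borel_measurable lebesgue"
    using assms by (auto simp: is_momentum_wave_def square_integrable_def)
  have [measurable]: "F R \<in> borel_measurable lebesgue" for R
    unfolding F_def by (rule borel_measurable_truncated_fourier) fact
  have lim: "(D \<phi>\<^sub>1 \<longlongrightarrow> 0) at_top" "(D \<phi>\<^sub>2 \<longlongrightarrow> 0) at_top"
    using assms unfolding is_momentum_wave_def D_def F_def by auto
  let ?I = "\<integral>\<^sup>+ p. ennreal ((cmod (\<phi>\<^sub>1 p - \<phi>\<^sub>2 p))\<^sup>2) \<partial>lebesgue"
  have "?I \<le> 2 * (D \<phi>\<^sub>1 R + D \<phi>\<^sub>2 R)" for R
  proof -
    have "(cmod (a - b))\<^sup>2 \<le> 2 * ((cmod (a - c))\<^sup>2 + (cmod (b - c))\<^sup>2)" for a b c :: complex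
    proof -
      have "cmod (a - b) \<le> cmod (a - c) + cmod (b - c)"
        using norm_triangle_ineq4[of "a - c" "b - c"] by simp
      then have "(cmod (a - b))\<^sup>2 \<le> (cmod (a - c) + cmod (b - c))\<^sup>2"
        by (simp add: power_mono)
      also have "\<dots> \<le> 2 * ((cmod (a - c))\<^sup>2 + (cmod (b - c))\<^sup>2)"
        using sum_squares_bound[of "cmod (a - c)" "cmod (b - c)"] by (simp add: power2_sum)
      finally show ?thesis .
    qed
    then have "?I \<le> (\<integral>\<^sup>+ p. 2 * (ennreal ((cmod (\<phi>\<^sub>1 p - F R p))\<^sup>2)
        + ennreal ((cmod (\<phi>\<^sub>2 p - F R p))\<^sup>2)) \<partial>lebesgue)"
      by (intro nn_integral_mono)
         (simp add: ennreal_leI ennreal_mult[symmetric] flip: ennreal_plus ennreal_numeral)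
    also have "\<dots> = 2 * (D \<phi>\<^sub>1 R + D \<phi>\<^sub>2 R)"
      unfolding D_def by (simp add: nn_integral_cmult nn_integral_add)
    finally show ?thesis .
  qed
  moreover have "((\<lambda>R. 2 * (D \<phi>\<^sub>1 R + D \<phi>\<^sub>2 R)) \<longlongrightarrow> 2 * (0 + 0)) at_top"
    by (intro ennreal_tendsto_cmult tendsto_add lim) auto
  ultimately have "?I \<le> 2 * (0 + 0)"
    by (intro tendsto_lowerbound[where F = at_top]) auto
  then have "?I = 0" by simp
  then show ?thesis
    by (subst (asm) nn_integral_0_iff_AE) auto
qed

lemma confidence_width_cong_AE:
  assumes "square_integrable f" and "square_integrable g" and "AE x in lebesgue. f x = g x"
  shows "confidence_width \<theta> f = confidence_width \<theta> g"
proof -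
  have "(LINT x:X|lebesgue. (cmod (f x))\<^sup>2) = (LINT x:X|lebesgue. (cmod (g x))\<^sup>2)"
    if [measurable]: "X \<in> sets lebesgue" for X
  proof -
    have [measurable]: "f \<in> borel_measurable lebesgue" "g \<in> borel_measurable lebesgue"
      using assms by (auto simp: square_integrable_def)
    show ?thesis
      unfolding set_lebesgue_integral_def
      by (rule integral_cong_AE) (use assms(3) in auto)
  qed
  then show ?thesis
    unfolding confidence_width_def by (metis (no_types, lifting))
qed

end

theory Submission imports Defs "HOL-Probability.Sinc_Integral" begin

text \<open>Take a unit vector \<open>f\<close> that is odd and supported in a short interval \<open>X\<close>, and a unit vector
  \<open>g\<close> that is even and whose Fourier transform is concentrated on a short interval \<open>Y\<close>. By parity
  they are orthogonal, so \<open>\<psi> = \<alpha> f + \<beta> g\<close> with \<open>\<alpha>\<^sup>2 = \<theta>\<^sub>x\<close> and \<open>\<beta>\<^sup>2 = 1 - \<theta>\<^sub>x\<close> is a unit vector.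
  The cross term also vanishes over \<open>X\<close>, and in momentum space it vanishes pointwise, since the
  transform of \<open>f\<close> is imaginary and that of \<open>g\<close> is real. Hence \<open>X\<close> carries mass at least
  \<open>\<alpha>\<^sup>2 = \<theta>\<^sub>x\<close> and \<open>Y\<close> carries mass at least \<open>\<beta>\<^sup>2 \<ge> \<theta>\<^sub>p\<close>. With \<open>f\<close> linear on \<open>X\<close> and \<open>g\<close> a sinc
  function everything is explicit: the truncated transforms of \<open>g\<close> are sums of sine integrals
  \<open>Si (R t)\<close>, and their \<open>L\<^sup>2\<close> convergence to a box follows by scaling from
  \<open>\<bar>Si t - \<pi>/2\<bar> \<le> 2/t\<close>, so Plancherel's theorem is not needed.\<close>

section \<open>Integrals of odd functions and domination by
  \<open>inverse (1 + x\<^sup>2)\<close>\<close>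

lemma integral_odd_eq_0:
  fixes h :: "real \<Rightarrow> real"
  assumes [measurable]: "h \<in> borel_measurable borel" and "\<And>x. h (- x) = - h x"
  shows "integral\<^sup>L lebesgue h = 0"
proof -
  \<comment> \<open>The reflection of the line turns the integral into its own negative. If
    \<open>h\<close> is not integrable, both sides are the default value 0.\<close>
  have "integral\<^sup>L lborel h = (\<integral>x. h (0 + -1 * x) \<partial>lborel)"
    by (subst lborel_integral_real_affine[of "-1" h 0]) simp_all
  also have "\<dots> = - integral\<^sup>L lborel h"
    using assms(2) by simp
  finally show ?thesis by (simp add: integral_completion)
qed

lemma nn_integral_inverse_1_plus_square:
  "(\<integral>\<^sup>+ x. ennreal (inverse (1 + x\<^sup>2)) \<partial>lborel) < \<infinity>"
  using integrable_inverse_1_plus_square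
  by (simp add: set_integrable_def integrable_iff_bounded einterval_def)

lemma nn_integral_le_inverse_1_plus_square:
  fixes F :: "real \<Rightarrow> real"
  assumes "\<And>x. F x \<le> C * inverse (1 + x\<^sup>2)" and "C \<ge> 0"
  shows "(\<integral>\<^sup>+ x. ennreal (F x) \<partial>lborel) < \<infinity>"
proof -
  have "(\<integral>\<^sup>+ x. ennreal (F x) \<partial>lborel) \<le> (\<integral>\<^sup>+ x. ennreal C * ennreal (inverse (1 + x\<^sup>2)) \<partial>lborel)"
    using assms by (intro nn_integral_mono) (simp add: ennreal_mult[symmetric] ennreal_leI)
  also have "\<dots> = ennreal C * (\<integral>\<^sup>+ x. ennreal (inverse (1 + x\<^sup>2)) \<partial>lborel)"
    by (simp add: nn_integral_cmult)
  also have "\<dots> < \<infinity>"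
    using nn_integral_inverse_1_plus_square by (simp add: ennreal_mult_less_top)
  finally show ?thesis .
qed

text \<open>For \<open>\<bar>x\<bar> \<le> 1\<close> the factor \<open>1 + x\<^sup>2\<close> is at
  most 2; for larger \<open>\<bar>x\<bar>\<close> it is at most \<open>2 * x\<^sup>2\<close>. So
  boundedness near 0 and decay of order 1/|x| give square integrability. This is applied to the sine
  integral defect and to the transform of the ramp.\<close>

lemma square_le_inverse_1_plus_square:
  fixes y x A B :: real
  assumes "\<bar>x\<bar> \<le> 1 \<Longrightarrow> \<bar>y\<bar> \<le> A" and "\<bar>x\<bar> > 1 \<Longrightarrow> \<bar>y\<bar> \<le> B / \<bar>x\<bar>"
  shows "y\<^sup>2 \<le> 2 * (A\<^sup>2 + B\<^sup>2) * inverse (1 + x\<^sup>2)"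
proof (cases "\<bar>x\<bar> \<le> 1")
  case True
  have "y\<^sup>2 \<le> A\<^sup>2" using assms(1)[OF True] by (metis abs_ge_zero power2_abs power_mono)
  moreover have "x\<^sup>2 \<le> 1" using True by (simp add: abs_square_le_1)
  ultimately have "y\<^sup>2 * (1 + x\<^sup>2) \<le> A\<^sup>2 * 2" by (intro mult_mono) auto
  then have "y\<^sup>2 * (1 + x\<^sup>2) \<le> 2 * (A\<^sup>2 + B\<^sup>2)" using zero_le_power2[of B] by argo
  then show ?thesis by (simp add: field_simps add_pos_nonneg)
next
  case False
  then have "\<bar>y\<bar> * \<bar>x\<bar> \<le> B" using assms(2) by (simp add: field_simps)
  then have "(\<bar>y\<bar> * \<bar>x\<bar>)\<^sup>2 \<le> B\<^sup>2" by (intro power_mono) auto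
  then have *: "y\<^sup>2 * x\<^sup>2 \<le> B\<^sup>2" by (simp add: power_mult_distrib)
  have "1 \<le> x\<^sup>2" using False by (metis abs_square_le_1 linorder_linear)
  then have "y\<^sup>2 * 1 \<le> y\<^sup>2 * x\<^sup>2" by (intro mult_left_mono) auto
  then have "y\<^sup>2 * (1 + x\<^sup>2) \<le> 2 * (A\<^sup>2 + B\<^sup>2)" using * zero_le_power2[of A] by (simp only: distrib_left mult_1_right)
  then show ?thesis by (simp add: field_simps add_pos_nonneg)
qed

section \<open>The sine integral and its distance from its limits\<close>

lemma const_over_at_top: "((\<lambda>x::real. s / x) \<longlongrightarrow> 0) at_top"
  by (rule tendsto_divide_0[OF tendsto_const filterlim_at_top_imp_at_infinity[OF filterlim_ident]])

lemma Si_minus: "Si (- t) = - Si t"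
  using Si_neg[of t] Si_neg[of "- t"] by (cases "t \<ge> 0") auto

lemma Si_remainder:
  assumes "t > 0"
  shows "\<bar>Si t - pi / 2\<bar> \<le> 2 / t"
proof -
  \<comment> \<open>\<open>F (-1)\<close> increases and \<open>F 1\<close> decreases to \<open>\<pi>/2\<close>.\<close>
  define F where "F s x = Si x + cos x / x + s / x" for s x :: real
  \<comment> \<open>The derivative sin x / x of \<open>Si\<close> cancels the leading term of the
    derivative of cos x / x. What remains has constant sign for s = 1 and for s = -1.\<close>
  have D: "(F s has_real_derivative - (cos x + s) / x\<^sup>2) (at x)" if "x > 0" for s x
    unfolding F_def using that
    by (auto intro!: derivative_eq_intros DERIV_Si simp: field_simps power2_eq_square)
  have lim: "(F s \<longlongrightarrow> pi / 2) at_top" for s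
  proof -
    have "((\<lambda>x::real. cos x / x) \<longlongrightarrow> 0) at_top"
    proof (rule tendsto_rabs_zero_cancel, rule tendsto_sandwich[of "\<lambda>_. 0" _ _ "\<lambda>x. 1 / x"])
      show "\<forall>\<^sub>F x::real in at_top. \<bar>cos x / x\<bar> \<le> 1 / x"
        using eventually_gt_at_top[of 0] by eventually_elim (simp add: divide_right_mono)
      show "((\<lambda>x::real. 1 / x) \<longlongrightarrow> 0) at_top" by (rule const_over_at_top)
    qed auto
    moreover have "((\<lambda>x::real. s / x) \<longlongrightarrow> 0) at_top" by (rule const_over_at_top)
    ultimately have "(F s \<longlongrightarrow> pi / 2 + 0 + 0) at_top"
      unfolding F_def by (intro tendsto_add Si_at_top)
    then show ?thesis by simp
  qed
  have "F (-1) t \<le> pi / 2"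
  proof (rule tendsto_lowerbound[OF lim])
    show "\<forall>\<^sub>F x in at_top. F (-1) t \<le> F (-1) x"
      using eventually_ge_at_top[of t]
    proof eventually_elim
      case (elim x)
      show ?case
      proof (rule DERIV_nonneg_imp_nondecreasing[OF elim])
        fix y assume "t \<le> y"
        then show "\<exists>z. (F (-1) has_real_derivative z) (at y) \<and> 0 \<le> z"
          using D[of y "-1"] assms by (intro exI[of _ "- (cos y + -1) / y\<^sup>2"]) auto
      qed
    qed
  qed simp
  moreover have "pi / 2 \<le> F 1 t"
  proof (rule tendsto_upperbound[OF lim])
    show "\<forall>\<^sub>F x in at_top. F 1 x \<le> F 1 t"
      using eventually_ge_at_top[of t]
    proof eventually_elim
      case (elim x)
      show ?case
      proof (rule DERIV_nonpos_imp_nonincreasing[OF elim])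
        fix y assume "t \<le> y"
        moreover have "- 1 \<le> cos y" by simp
        ultimately show "\<exists>z. (F 1 has_real_derivative z) (at y) \<and> z \<le> 0"
          using D[of y 1] assms
          by (intro exI[of _ "- (cos y + 1) / y\<^sup>2"] conjI divide_nonpos_nonneg) auto
      qed
    qed
  qed simp
  \<comment> \<open>Monotonicity confines \<open>Si t + cos t / t\<close> to within 1/t of pi/2;
    removing the cosine term costs another 1/t.\<close>
  moreover have "\<bar>cos t / t\<bar> \<le> 1 / t" using assms by (simp add: divide_right_mono)
  moreover have "F (-1) t = Si t + cos t / t - 1 / t" "F 1 t = Si t + cos t / t + 1 / t" "2 / t = 1 / t + 1 / t"
    by (simp_all add: F_def)
  ultimately show ?thesis by arith
qed

lemma DERIV_Si_mult: "((\<lambda>x. Si (x * m)) has_real_derivative sinc (x * m) * m) (at x)"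
  by (rule DERIV_chain2[OF DERIV_Si]) (auto intro!: derivative_eq_intros)

text \<open>As R tends to infinity, Si (R t) tends to pi/2 times \<open>sgn t\<close>. Since that
  limit is invariant under scaling by R > 0, the error at R is just \<open>Si_defect\<close>
  evaluated at R t.\<close>

definition Si_defect :: "real \<Rightarrow> real" where
  "Si_defect t = Si t - pi / 2 * sgn t"

lemma borel_measurable_Si_defect [measurable]: "Si_defect \<in> borel_measurable borel"
  unfolding Si_defect_def[abs_def] by measurable

lemma nn_integral_Si_defect: "(\<integral>\<^sup>+ t. ennreal ((Si_defect t)\<^sup>2) \<partial>lborel) < \<infinity>"
proof -
  obtain B where B: "\<And>t. \<bar>Si t\<bar> \<le> B" using bounded_Si by blast
  have "(Si_defect t)\<^sup>2 \<le> 2 * ((B + pi / 2)\<^sup>2 + 2\<^sup>2) * inverse (1 + t\<^sup>2)" for t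
  proof (rule square_le_inverse_1_plus_square)
    have "\<bar>Si_defect t\<bar> \<le> \<bar>Si t\<bar> + \<bar>pi / 2 * sgn t\<bar>"
      unfolding Si_defect_def by (rule abs_triangle_ineq4)
    also have "\<dots> \<le> B + pi / 2"
      by (intro add_mono B) (simp add: sgn_if)
    finally show "\<bar>Si_defect t\<bar> \<le> B + pi / 2" .
    assume "\<bar>t\<bar> > 1"
    then show "\<bar>Si_defect t\<bar> \<le> 2 / \<bar>t\<bar>"
      using Si_remainder[of t] Si_remainder[of "- t"]
      by (cases "t > 0") (auto simp: Si_defect_def Si_minus abs_if split: if_splits)
  qed
  then show ?thesis by (rule nn_integral_le_inverse_1_plus_square) simp
qed

section \<open>The squared norm of the sinc function\<close>

lemma nn_integral_sinc_squared: "(\<integral>\<^sup>+ t. ennreal ((sinc t)\<^sup>2) \<partial>lborel) = ennreal pi"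
proof -
  \<comment> \<open>Integration by parts of (sin t / t)^2 gives the boundary term - (sin t)^2 / t
    and the integral of sin (2 t) / t, which is Si (2 t). Writing the boundary term with
    \<open>sinc\<close> also gives the right value at 0.\<close>
  define G where "G t = Si (t * 2) - sin t * sinc t" for t
  have D: "(G has_real_derivative (sinc t)\<^sup>2) (at t)" for t
  proof (cases "t = 0")
    case True
    have "((\<lambda>t. sin t * sinc t) has_real_derivative 1) (at 0)"
    proof -
      \<comment> \<open>For t different from 0, the difference quotient of
        \<open>sin t * sinc t\<close> at 0 is \<open>sinc t * sinc t\<close>.\<close>
      have "((\<lambda>t. sinc t * sinc t) \<longlongrightarrow> 1 * 1) (at 0)"
        by (intro tendsto_mult) (use isCont_sinc[of 0] in \<open>simp_all add: isCont_def\<close>)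
      then show ?thesis
        unfolding has_field_derivative_iff
        by (rule filterlim_cong[THEN iffD1, rotated -1]) (auto simp: eventually_at_filter)
    qed
    moreover have "((\<lambda>t. Si (t * 2)) has_real_derivative 2) (at 0)"
      using DERIV_Si_mult[of 2 0] by simp
    ultimately have "(G has_real_derivative 2 - 1) (at 0)"
      unfolding G_def by (rule DERIV_diff[rotated])
    then show ?thesis using True by simp
  next
    case False
    have "((\<lambda>t. sin t * (sin t / t)) has_real_derivative
        cos t * (sin t / t) + (cos t * t - sin t) / t\<^sup>2 * sin t) (at t)"
      using False by (auto intro!: derivative_eq_intros simp: field_simps power2_eq_square)
    from DERIV_diff[OF DERIV_Si_mult[of 2 t] this]
    have "((\<lambda>t. Si (t * 2) - sin t * (sin t / t)) has_real_derivative
        (sin (2 * t) / (2 * t)) * 2 - (cos t * (sin t / t) + (cos t * t - sin t) / t\<^sup>2 * sin t)) (at t)"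
      using False by (simp add: mult.commute[of t 2])
    moreover have "(sin (2 * t) / (2 * t)) * 2 - (cos t * (sin t / t) + (cos t * t - sin t) / t\<^sup>2 * sin t)
        = (sinc t)\<^sup>2"
      using False by (simp add: sin_double diff_divide_distrib left_diff_distrib power2_eq_square)
    ultimately have "((\<lambda>t. Si (t * 2) - sin t * (sin t / t)) has_real_derivative (sinc t)\<^sup>2) (at t)"
      by simp
    then show ?thesis
      by (rule has_field_derivative_transform_within_open[where S = "- {0}"])
         (use False in \<open>auto simp: G_def\<close>)
  qed
  have lim: "(G \<longlongrightarrow> pi / 2) at_top"
  proof -
    have "((\<lambda>t. sin t * sinc t) \<longlongrightarrow> 0) at_top"
    proof (rule tendsto_rabs_zero_cancel, rule tendsto_sandwich[of "\<lambda>_. 0" _ _ "\<lambda>x. 1 / x"])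
      show "\<forall>\<^sub>F x::real in at_top. \<bar>sin x * sinc x\<bar> \<le> 1 / x"
        using eventually_gt_at_top[of 0]
      proof eventually_elim
        case (elim x)
        have "\<bar>sin x\<bar> * \<bar>sin x\<bar> \<le> 1 * 1" by (intro mult_mono) auto
        then show ?case using elim by (simp add: abs_mult divide_right_mono)
      qed
      show "((\<lambda>x::real. 1 / x) \<longlongrightarrow> 0) at_top" by (rule const_over_at_top)
    qed auto
    moreover have "((\<lambda>t. Si (t * 2)) \<longlongrightarrow> pi / 2) at_top"
      by (rule filterlim_compose[OF Si_at_top])
         (rule filterlim_at_top_mult_tendsto_pos[OF tendsto_const _ filterlim_ident], simp)
    ultimately have "(G \<longlongrightarrow> pi / 2 - 0) at_top" unfolding G_def by (intro tendsto_diff)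
    then show ?thesis by simp
  qed
  have "G 0 = 0" using Si_minus[of 0] by (simp add: G_def)
  have half: "(\<integral>\<^sup>+ t. ennreal ((sinc t)\<^sup>2) * indicator {0..} t \<partial>lborel) = ennreal (pi / 2)"
    using nn_integral_FTC_atLeast[of "\<lambda>t. (sinc t)\<^sup>2" 0 G, OF _ D _ lim] \<open>G 0 = 0\<close> by simp
  \<comment> \<open>The two half-lines overlap only in the null set {0}; evenness makes their
    contributions equal.\<close>
  have "(\<integral>\<^sup>+ t. ennreal ((sinc t)\<^sup>2) \<partial>lborel)
      = (\<integral>\<^sup>+ t. ennreal ((sinc t)\<^sup>2) * indicator {0..} t + ennreal ((sinc t)\<^sup>2) * indicator {..0} t \<partial>lborel)"
    by (intro nn_integral_cong_AE AE_I[of _ _ "{0}"]) (auto simp: indicator_def)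
  also have "\<dots> = ennreal (pi / 2) + (\<integral>\<^sup>+ t. ennreal ((sinc t)\<^sup>2) * indicator {..0} t \<partial>lborel)"
    by (subst nn_integral_add) (simp_all only: half, measurable)
  also have "(\<integral>\<^sup>+ t. ennreal ((sinc t)\<^sup>2) * indicator {..0} t \<partial>lborel)
      = (\<integral>\<^sup>+ t. ennreal ((sinc t)\<^sup>2) * indicator {0..} t \<partial>lborel)"
    by (subst nn_integral_real_affine[of _ "-1" 0]) (auto intro!: nn_integral_cong simp: indicator_def)
  also note half
  finally show ?thesis by (simp flip: ennreal_plus)
qed


section \<open>Cosine and sine integrals over symmetric intervals\<close>

lemma LINT_FTC_Icc:
  fixes f :: "real \<Rightarrow> real"
  assumes "a \<le> b" and "\<And>x. (F has_real_derivative f x) (at x)" and "continuous_on {a..b} f"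
  shows "(LINT x:{a..b}|lebesgue. f x) = F b - F a"
proof -
  have "(f has_integral (F b - F a)) {a..b}"
    using assms by (intro fundamental_theorem_of_calculus)
      (auto simp: has_real_derivative_iff_has_vector_derivative[symmetric]
        intro: has_field_derivative_at_within)
  then show ?thesis
    using absolutely_integrable_continuous_real[OF assms(3)]
    by (simp add: set_lebesgue_integral_eq_integral integral_unique)
qed

lemma LINT_odd_Icc_eq_0:
  fixes h :: "real \<Rightarrow> real"
  assumes [measurable]: "h \<in> borel_measurable borel" and "\<And>x. h (- x) = - h x"
  shows "(LINT x:{- R..R}|lebesgue. h x) = 0"
  unfolding set_lebesgue_integral_def
  by (rule integral_odd_eq_0) (use assms(2) in \<open>auto simp: indicator_def\<close>)

text \<open>Euler's formula splits the kernel; boundedness of cosine and sine keeps both parts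
  integrable. For a real wave the real part thus sees only its even component and the imaginary part
  only its odd one.\<close>

lemma truncated_fourier_of_real:
  assumes [measurable]: "u \<in> borel_measurable borel" and int: "set_integrable lebesgue {- R..R} u"
  shows "truncated_fourier hbar R (\<lambda>x. complex_of_real (u x)) p =
    complex_of_real (1 / sqrt (2 * pi * hbar)) *
      (complex_of_real (LINT x:{- R..R}|lebesgue. u x * cos (p / hbar * x))
        - \<i> * complex_of_real (LINT x:{- R..R}|lebesgue. u x * sin (p / hbar * x)))"
proof -
  let ?c = "\<lambda>x. indicat_real {- R..R} x * (u x * cos (p / hbar * x))"
  let ?s = "\<lambda>x. indicat_real {- R..R} x * (u x * sin (p / hbar * x))"
  have i: "integrable lebesgue (\<lambda>x. indicat_real {- R..R} x * u x)"
    using int by (simp add: set_integrable_def)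
  have "integrable lebesgue (\<lambda>x. indicat_real {- R..R} x * (u x * w x))"
    if [measurable]: "w \<in> borel_measurable borel" and "\<And>x. \<bar>w x\<bar> \<le> 1" for w :: "real \<Rightarrow> real"
    by (rule Bochner_Integration.integrable_bound[OF i])
       (auto simp: abs_mult that intro!: measurable_completion mult_left_mono mult_left_le)
  from this[of "\<lambda>x. cos (p / hbar * x)"] this[of "\<lambda>x. sin (p / hbar * x)"]
  have cs: "integrable lebesgue ?c" "integrable lebesgue ?s" by simp_all
  have "indicat_real {- R..R} x *\<^sub>R (exp (- (\<i> * complex_of_real (p * x / hbar))) * complex_of_real (u x))
      = complex_of_real (?c x) - \<i> * complex_of_real (?s x)" for x
  proof -
    have "exp (- (\<i> * complex_of_real (p * x / hbar))) = cis (- (p / hbar * x))"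
      by (simp add: cis_conv_exp)
    then show ?thesis by (simp add: complex_eq_iff)
  qed
  moreover have "(\<integral>x. complex_of_real (?c x) - \<i> * complex_of_real (?s x) \<partial>lebesgue)
      = complex_of_real (\<integral>x. ?c x \<partial>lebesgue) - \<i> * complex_of_real (\<integral>x. ?s x \<partial>lebesgue)"
    by (simp only: Bochner_Integration.integral_diff[OF integrable_of_real[OF cs(1)]
          integrable_mult_right[OF integrable_of_real[OF cs(2)]]]
        integral_mult_right_zero integral_complex_of_real)
  ultimately show ?thesis
    by (simp only: truncated_fourier_def set_lebesgue_integral_def real_scaleR_def)
qed

text \<open>The product sin (k x) cos (q x) is half the sum of the sines of (k + q) x and (k - q) x;
  divided by x, each integrates to a sine integral. The antiderivative is odd, so the symmetric
  interval doubles its value and the 2 in its denominator disappears.\<close>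

lemma LINT_sinc_cos:
  assumes "k > 0" and "R \<ge> 0"
  shows "(LINT x:{- R..R}|lebesgue. sinc (k * x) * cos (q * x)) = (Si (R * (k + q)) + Si (R * (k - q))) / k"
proof -
  define A where "A x = (Si (x * (k + q)) + Si (x * (k - q))) / (2 * k)" for x
  have "(LINT x:{- R..R}|lebesgue. sinc (k * x) * cos (q * x)) = A R - A (- R)"
  proof (rule LINT_FTC_Icc)
    show "continuous_on {- R..R} (\<lambda>x. sinc (k * x) * cos (q * x))"
      by (intro continuous_intros continuous_on_sinc)
  next
    fix x
    have "(A has_real_derivative (sinc (x * (k + q)) * (k + q) + sinc (x * (k - q)) * (k - q)) / (2 * k)) (at x)"
      unfolding A_def by (intro DERIV_cdivide DERIV_add DERIV_Si_mult)
    moreover have "(sinc (x * (k + q)) * (k + q) + sinc (x * (k - q)) * (k - q)) / (2 * k) = sinc (k * x) * cos (q * x)"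
    proof (cases "x = 0")
      case True
      then show ?thesis using assms by simp
    next
      case False
      have s: "sinc (x * m) * m = sin (x * m) / x" for m
        using False by simp
      have "sin (x * (k + q)) + sin (x * (k - q)) = 2 * (sin (k * x) * cos (q * x))"
        by (simp add: sin_add sin_diff algebra_simps)
      then have "(sin (x * (k + q)) / x + sin (x * (k - q)) / x) / (2 * k) = sin (k * x) / (k * x) * cos (q * x)"
        using False assms by (simp add: add_divide_distrib[symmetric])
      then show ?thesis unfolding s using False assms by simp
    qed
    ultimately show "(A has_real_derivative sinc (k * x) * cos (q * x)) (at x)" by simp
  qed (use assms in simp)
  also have "A (- R) = - A R"
    by (simp add: A_def Si_minus minus_divide_left del: mult_minus_right)
  finally show ?thesis by (simp add: A_def)
qed

section \<open>The sine transform of the ramp and its square integrability\<close>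

lemma LINT_x_sin:
  fixes d q :: real
  assumes "d \<ge> 0" and "q \<noteq> 0"
  shows "(LINT x:{- d..d}|lebesgue. x * sin (q * x)) = 2 * (sin (q * d) / q\<^sup>2 - d * cos (q * d) / q)"
proof -
  have "(LINT x:{- d..d}|lebesgue. x * sin (q * x))
      = (sin (q * d) / q\<^sup>2 - d * cos (q * d) / q) - (sin (q * - d) / q\<^sup>2 - - d * cos (q * - d) / q)"
    by (rule LINT_FTC_Icc[where F = "\<lambda>x::real. sin (q * x) / q\<^sup>2 - x * cos (q * x) / q"])
       (use assms in \<open>auto intro!: derivative_eq_intros continuous_intros simp: field_simps power2_eq_square\<close>)
  then show ?thesis by simp
qed

text \<open>A bound uniform in q, to be used near q = 0, where the closed formula divides by powers
  of q. The integrand is at most d in absolute value on an interval of length 2 d.\<close>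

lemma abs_LINT_x_sin_le:
  fixes d q :: real
  assumes "d \<ge> 0"
  shows "\<bar>LINT x:{- d..d}|lebesgue. x * sin (q * x)\<bar> \<le> 2 * d\<^sup>2"
proof -
  have c: "continuous_on {- d..d} (\<lambda>x. x * sin (q * x))" by (intro continuous_intros)
  have "norm (integral {- d..d} (\<lambda>x. x * sin (q * x))) \<le> d * (d - - d)"
  proof (rule integral_bound)
    fix x assume "x \<in> {- d..d}"
    then have "\<bar>x\<bar> * \<bar>sin (q * x)\<bar> \<le> d * 1" by (intro mult_mono) auto
    then show "norm (x * sin (q * x)) \<le> d" by (simp add: abs_mult)
  qed (use assms c in auto)
  then show ?thesis
    using absolutely_integrable_continuous_real[OF c]
    by (simp add: set_lebesgue_integral_eq_integral power2_eq_square)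
qed

text \<open>The first argument of the transforms below is the parameter of the wave, the second one is
  the wave number \<open>q = p / hbar\<close>.\<close>

definition ramp_transform :: "real \<Rightarrow> real \<Rightarrow> real" where
  "ramp_transform d q = (LINT x:{- d..d}|lebesgue. x * sin (q * x))"

text \<open>The closed formula gives measurability and decay of order 1/|q| for |q| > 1; the uniform
  bound covers the remaining q.\<close>

lemma integrable_ramp_transform:
  assumes "d > 0"
  shows "ramp_transform d \<in> borel_measurable borel"
    and "integrable lborel (\<lambda>q. (ramp_transform d q)\<^sup>2)"
proof -
  have "ramp_transform d q = (if q = 0 then 0 else 2 * (sin (q * d) / q\<^sup>2 - d * cos (q * d) / q))" for q
    using assms by (simp add: ramp_transform_def LINT_x_sin)
  then have *: "ramp_transform d = (\<lambda>q. if q = 0 then 0 else 2 * (sin (q * d) / q\<^sup>2 - d * cos (q * d) / q))"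
    by auto
  show [measurable]: "ramp_transform d \<in> borel_measurable borel"
    unfolding * by measurable
  have "(ramp_transform d q)\<^sup>2 \<le> 2 * ((2 * d\<^sup>2)\<^sup>2 + (2 * (1 + d))\<^sup>2) * inverse (1 + q\<^sup>2)" for q
  proof (rule square_le_inverse_1_plus_square)
    show "\<bar>ramp_transform d q\<bar> \<le> 2 * d\<^sup>2"
      unfolding ramp_transform_def using assms by (intro abs_LINT_x_sin_le) simp
    assume q: "\<bar>q\<bar> > 1"
    have "\<bar>sin (q * d) / q\<^sup>2\<bar> \<le> 1 / \<bar>q\<bar>"
    proof -
      have "\<bar>sin (q * d) / q\<^sup>2\<bar> \<le> 1 / q\<^sup>2" by (simp add: divide_right_mono)
      also have "\<dots> \<le> 1 / \<bar>q\<bar>"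
      proof (rule divide_left_mono)
        have "\<bar>q\<bar> * 1 \<le> \<bar>q\<bar> * \<bar>q\<bar>" using q by (intro mult_left_mono) auto
        then show "\<bar>q\<bar> \<le> q\<^sup>2" by (simp add: power2_eq_square)
      qed (use q in \<open>auto simp: zero_less_mult_iff\<close>)
      finally show ?thesis .
    qed
    moreover have "\<bar>d * cos (q * d) / q\<bar> \<le> d / \<bar>q\<bar>"
      using assms by (simp add: abs_mult divide_right_mono)
    ultimately have "\<bar>sin (q * d) / q\<^sup>2 - d * cos (q * d) / q\<bar> \<le> 1 / \<bar>q\<bar> + d / \<bar>q\<bar>"
      by linarith
    then show "\<bar>ramp_transform d q\<bar> \<le> 2 * (1 + d) / \<bar>q\<bar>"
      using q by (auto simp: * abs_mult add_divide_distrib distrib_left)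
  qed
  then have "(\<integral>\<^sup>+ q. ennreal ((ramp_transform d q)\<^sup>2) \<partial>lborel) < \<infinity>"
    by (rule nn_integral_le_inverse_1_plus_square) simp
  then show "integrable lborel (\<lambda>q. (ramp_transform d q)\<^sup>2)"
    by (simp add: integrable_iff_bounded)
qed


section \<open>The two component waves and their norms\<close>

text \<open>The factor normalises: x^2 has integral 2 d^3 / 3 over [-d, d].\<close>

definition ramp :: "real \<Rightarrow> real \<Rightarrow> real" where
  "ramp d x = sqrt (3 / (2 * d ^ 3)) * x * indicator {- d..d} x"

text \<open>The factor normalises, since the square of sinc (k x) has integral pi / k for k >
  0.\<close>

definition sinc_wave :: "real \<Rightarrow> real \<Rightarrow> real" where
  "sinc_wave k x = sqrt (k / pi) * sinc (k * x)"

text \<open>For k > 0, a box of height \<open>sqrt (1 / (2 * k))\<close> on (-k, k). It is written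
  with signs because these arise as the limits of the sine integrals in
  \<open>LINT_sinc_cos\<close>.\<close>

definition sinc_transform :: "real \<Rightarrow> real \<Rightarrow> real" where
  "sinc_transform k q = sqrt (1 / (2 * k)) * (sgn (k + q) + sgn (k - q)) / 2"

lemma borel_measurable_ramp [measurable]: "ramp d \<in> borel_measurable borel"
  unfolding ramp_def[abs_def] by measurable

lemma borel_measurable_sinc_wave [measurable]: "sinc_wave k \<in> borel_measurable borel"
proof -
  have "(\<lambda>x. sinc (k * x)) \<in> borel_measurable borel"
    by (rule measurable_compose[OF _ borel_measurable_sinc]) measurable
  then show ?thesis unfolding sinc_wave_def[abs_def] by measurable
qed

lemma borel_measurable_sinc_transform [measurable]: "sinc_transform k \<in> borel_measurable borel"
  unfolding sinc_transform_def[abs_def] by measurable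

lemma ramp_minus: "ramp d (- x) = - ramp d x"
  by (auto simp: ramp_def indicator_def)

lemma sinc_wave_minus: "sinc_wave k (- x) = sinc_wave k x"
  by (auto simp: sinc_wave_def)

lemma continuous_on_sinc_wave: "continuous_on S (sinc_wave k)"
  unfolding sinc_wave_def by (intro continuous_intros continuous_on_sinc)

lemma integrable_continuous_indicator:
  fixes f :: "real \<Rightarrow> real"
  assumes "continuous_on {a..b} f"
  shows "integrable lebesgue (\<lambda>x. indicator {a..b} x * f x)"
  using absolutely_integrable_continuous_real[OF assms] by (simp add: set_integrable_def)

lemma ramp_squared:
  assumes "d > 0"
  shows "integrable lebesgue (\<lambda>x. (ramp d x)\<^sup>2)" and "(\<integral>x. (ramp d x)\<^sup>2 \<partial>lebesgue) = 1"
    and "(LINT x:{- d..d}|lebesgue. (ramp d x)\<^sup>2) = 1"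
proof -
  have e: "(ramp d x)\<^sup>2 = indicator {- d..d} x * (3 / (2 * d ^ 3) * x\<^sup>2)" for x
    using assms by (auto simp: ramp_def indicator_def power_mult_distrib)
  show "integrable lebesgue (\<lambda>x. (ramp d x)\<^sup>2)"
    unfolding e by (intro integrable_continuous_indicator continuous_intros)
  have "(LINT x:{- d..d}|lebesgue. c * x\<^sup>2) = c / 3 * d ^ 3 - c / 3 * (- d) ^ 3" for c
    by (rule LINT_FTC_Icc[where F = "\<lambda>x. c / 3 * x ^ 3"])
       (use assms in \<open>auto intro!: derivative_eq_intros continuous_intros\<close>)
  from this[of "3 / (2 * d ^ 3)"]
  have "(LINT x:{- d..d}|lebesgue. 3 / (2 * d ^ 3) * x\<^sup>2)
      = 3 / (2 * d ^ 3) / 3 * d ^ 3 - 3 / (2 * d ^ 3) / 3 * (- d) ^ 3" .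
  also have "\<dots> = 1" using assms by simp
  finally have "(LINT x:{- d..d}|lebesgue. 3 / (2 * d ^ 3) * x\<^sup>2) = 1" .
  then show "(\<integral>x. (ramp d x)\<^sup>2 \<partial>lebesgue) = 1"
    unfolding e by (simp only: set_lebesgue_integral_def real_scaleR_def)
  moreover have "(LINT x:{- d..d}|lebesgue. (ramp d x)\<^sup>2) = (\<integral>x. (ramp d x)\<^sup>2 \<partial>lebesgue)"
    unfolding set_lebesgue_integral_def e by (intro Bochner_Integration.integral_cong) (auto simp: indicator_def)
  ultimately show "(LINT x:{- d..d}|lebesgue. (ramp d x)\<^sup>2) = 1" by simp
qed

lemma sinc_wave_squared:
  assumes "k > 0"
  shows "integrable lebesgue (\<lambda>x. (sinc_wave k x)\<^sup>2)" and "(\<integral>x. (sinc_wave k x)\<^sup>2 \<partial>lebesgue) = 1"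
proof -
  have "ennreal pi = ennreal \<bar>k\<bar> * (\<integral>\<^sup>+ x. ennreal ((sinc (0 + k * x))\<^sup>2) \<partial>lborel)"
    by (subst nn_integral_sinc_squared[symmetric], rule nn_integral_real_affine) (use assms in \<open>simp_all, measurable\<close>)
  also have "\<dots> = ennreal pi * (\<integral>\<^sup>+ x. ennreal ((sinc_wave k x)\<^sup>2) \<partial>lborel)"
  proof -
    have m: "(\<lambda>x. sinc (k * x)) \<in> borel_measurable borel"
      by (rule measurable_compose[OF _ borel_measurable_sinc]) measurable
    have "ennreal \<bar>k\<bar> * ennreal ((sinc (0 + k * x))\<^sup>2) = ennreal pi * ennreal ((sinc_wave k x)\<^sup>2)" for x
    proof -
      have "k * (sinc (k * x))\<^sup>2 = pi * (sinc_wave k x)\<^sup>2"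
        using assms by (simp add: sinc_wave_def power_mult_distrib)
      then show ?thesis using assms by (cases "x = 0") (simp_all add: ennreal_mult[symmetric])
    qed
    then show ?thesis
      by (subst (1 2) nn_integral_cmult[symmetric]) (use m in \<open>simp_all, measurable\<close>)
  qed
  finally have *: "(\<integral>\<^sup>+ x. ennreal ((sinc_wave k x)\<^sup>2) \<partial>lborel) = 1"
  proof -
    assume e: "ennreal pi = ennreal pi * (\<integral>\<^sup>+ x. ennreal ((sinc_wave k x)\<^sup>2) \<partial>lborel)"
    have "ennreal pi * (\<integral>\<^sup>+ x. ennreal ((sinc_wave k x)\<^sup>2) \<partial>lborel) = ennreal pi * 1" using e by simp
    \<comment> \<open>Cancellation in \<open>ennreal\<close> is sound here because pi is neither 0
      nor infinite.\<close>
    from this[unfolded ennreal_mult_cancel_left] show ?thesis by (simp add: not_le)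
  qed
  then have "has_bochner_integral lebesgue (\<lambda>x. (sinc_wave k x)\<^sup>2) 1"
    by (intro has_bochner_integral_nn_integral) (auto simp: nn_integral_completion intro!: measurable_completion)
  then show "integrable lebesgue (\<lambda>x. (sinc_wave k x)\<^sup>2)" "(\<integral>x. (sinc_wave k x)\<^sup>2 \<partial>lebesgue) = 1"
    by (auto simp: has_bochner_integral_iff)
qed

lemma integrable_ramp_mult_sinc_wave: "integrable lebesgue (\<lambda>x. ramp d x * sinc_wave k x)"
proof -
  have "(\<lambda>x. ramp d x * sinc_wave k x)
      = (\<lambda>x. indicator {- d..d} x * (sqrt (3 / (2 * d ^ 3)) * x * sinc_wave k x))"
    by (auto simp: ramp_def)
  then show ?thesis
    by (simp only:) (intro integrable_continuous_indicator continuous_intros continuous_on_sinc_wave)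
qed

section \<open>Limits and errors of the component transforms\<close>

text \<open>Used with slope R / hbar and its negative: the factor \<open>1 / \<bar>c\<bar>\<close>
  then forces the error to 0 as R grows.\<close>

lemma nn_integral_Si_defect_affine:
  assumes "c \<noteq> 0"
  shows "(\<integral>\<^sup>+ p. ennreal ((Si_defect (t + c * p))\<^sup>2) \<partial>lborel)
    = ennreal (1 / \<bar>c\<bar>) * (\<integral>\<^sup>+ t. ennreal ((Si_defect t)\<^sup>2) \<partial>lborel)"
proof -
  have "(\<integral>\<^sup>+ t. ennreal ((Si_defect t)\<^sup>2) \<partial>lborel)
      = ennreal \<bar>c\<bar> * (\<integral>\<^sup>+ p. ennreal ((Si_defect (t + c * p))\<^sup>2) \<partial>lborel)"
    by (rule nn_integral_real_affine) (use assms in auto)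
  then show ?thesis
    using assms by (simp add: mult.assoc[symmetric] ennreal_mult[symmetric])
qed


text \<open>Writing each \<open>Si\<close> value as pi/2 times a sign plus a defect separates limit
  from error. The signs do not depend on R > 0, and together they form the box.\<close>

lemma LINT_sinc_wave_cos:
  assumes "k > 0" and "R > 0"
  shows "1 / sqrt (2 * pi) * (LINT x:{- R..R}|lebesgue. sinc_wave k x * cos (q * x)) =
    sinc_transform k q + sqrt (1 / (2 * k)) / pi * (Si_defect (R * (k + q)) + Si_defect (R * (k - q)))"
proof -
  have "(LINT x:{- R..R}|lebesgue. sinc_wave k x * cos (q * x))
      = sqrt (k / pi) * (LINT x:{- R..R}|lebesgue. sinc (k * x) * cos (q * x))"
    by (simp only: sinc_wave_def mult.assoc set_integral_mult_right)
  also have "\<dots> = sqrt (k / pi) / k * (Si (R * (k + q)) + Si (R * (k - q)))"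
    using assms by (simp only: LINT_sinc_cos) simp
  also have "1 / sqrt (2 * pi) * \<dots> = sqrt (1 / (2 * k)) / pi * (Si (R * (k + q)) + Si (R * (k - q)))"
  proof -
    have "1 / sqrt (2 * pi) * (sqrt (k / pi) / k) = sqrt (1 / (2 * k)) / pi"
      using assms by (simp add: real_sqrt_mult real_sqrt_divide field_simps)
    then show ?thesis by (simp only: mult.assoc[symmetric])
  qed
  also have "\<dots> = sinc_transform k q
      + sqrt (1 / (2 * k)) / pi * (Si_defect (R * (k + q)) + Si_defect (R * (k - q)))"
  proof -
    have "c / pi * (a + b) = c * (s + t) / 2 + c / pi * ((a - pi / 2 * s) + (b - pi / 2 * t))"
      for a b c s t :: real
      by (simp add: field_simps)
    moreover have "sgn (R * t) = sgn t" for t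
      using assms by (simp add: sgn_mult)
    ultimately show ?thesis by (simp only: Si_defect_def sinc_transform_def)
  qed
  finally show ?thesis .
qed

text \<open>Once [-R, R] contains the support of the ramp, truncation changes nothing, so the ramp
  contributes no error.\<close>

lemma LINT_ramp_sin:
  assumes "R \<ge> d"
  shows "(LINT x:{- R..R}|lebesgue. ramp d x * sin (q * x)) = sqrt (3 / (2 * d ^ 3)) * ramp_transform d q"
proof -
  have "(LINT x:{- R..R}|lebesgue. ramp d x * sin (q * x))
      = (LINT x:{- d..d}|lebesgue. sqrt (3 / (2 * d ^ 3)) * (x * sin (q * x)))"
    unfolding set_lebesgue_integral_def ramp_def
    by (intro Bochner_Integration.integral_cong) (use assms in \<open>auto simp: indicator_def\<close>)
  then show ?thesis by (simp add: ramp_transform_def)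
qed

lemma integrable_sinc_transform:
  assumes "k > 0"
  shows "integrable lborel (\<lambda>q. (sinc_transform k q)\<^sup>2)"
proof (rule Bochner_Integration.integrable_bound)
  \<comment> \<open>The closed interval is taken so that the dominating box also covers the nonzero
    values at the endpoints.\<close>
  show "integrable lborel (\<lambda>q. indicat_real {- k..k} q * (1 / (2 * k)))"
    by (intro integrable_mult_left integrable_real_indicator) (auto simp: emeasure_lborel_Icc_eq)
  show "AE q in lborel. norm ((sinc_transform k q)\<^sup>2) \<le> norm (indicat_real {- k..k} q * (1 / (2 * k)))"
    using assms
    by (intro AE_I2) (auto simp: sinc_transform_def indicator_def sgn_if power_mult_distrib power_divide
        intro!: divide_left_mono)
qed measurable

text \<open>The box \<open>sinc_transform k\<close> has half its height at the endpoints \<open>\<plusminus>k\<close>, hence the open interval.\<close>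

lemma LINT_sinc_transform:
  assumes "hbar > 0" and "k > 0"
  shows "(LINT p:{- (hbar * k)<..<hbar * k}|lebesgue. (sinc_transform k (p / hbar))\<^sup>2 / hbar) = 1"
proof -
  let ?Y = "{- (hbar * k)<..<hbar * k}"
  have "(LINT p:?Y|lebesgue. (sinc_transform k (p / hbar))\<^sup>2 / hbar)
      = (LINT p:?Y|lebesgue. 1 / (2 * k * hbar))"
  proof (rule set_lebesgue_integral_cong)
    show "\<forall>p. p \<in> ?Y \<longrightarrow> (sinc_transform k (p / hbar))\<^sup>2 / hbar = 1 / (2 * k * hbar)"
    proof (intro allI impI)
      fix p assume "p \<in> ?Y"
      then have "k + p / hbar > 0" "k - p / hbar > 0"
        using assms by (auto simp: field_simps)
      then show "(sinc_transform k (p / hbar))\<^sup>2 / hbar = 1 / (2 * k * hbar)"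
        using assms by (simp add: sinc_transform_def)
    qed
  qed simp
  also have "\<dots> = 1"
    using assms by (simp add: set_lebesgue_integral_def measure_def)
  finally show ?thesis .
qed

section \<open>The superposition and its momentum wave\<close>

definition mixed_wave :: "real \<Rightarrow> real \<Rightarrow> real \<Rightarrow> real \<Rightarrow> real \<Rightarrow> real" where
  "mixed_wave \<alpha> \<beta> d k x = \<alpha> * ramp d x + \<beta> * sinc_wave k x"

text \<open>The normalising factors of the Fourier transform are split as \<open>1 / sqrt hbar\<close>, which comes
  from the change of variable \<open>q = p / hbar\<close>, and \<open>1 / sqrt (2 * pi)\<close>, which \<open>sinc_transform\<close>
  contains and \<open>ramp_transform\<close> does not.\<close>

definition mixed_transform :: "real \<Rightarrow> real \<Rightarrow> real \<Rightarrow> real \<Rightarrow> real \<Rightarrow> real \<Rightarrow> complex" where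
  "mixed_transform hbar \<alpha> \<beta> d k p = complex_of_real (1 / sqrt hbar) *
    Complex (\<beta> * sinc_transform k (p / hbar))
      (- \<alpha> * sqrt (3 / (2 * d ^ 3)) / sqrt (2 * pi) * ramp_transform d (p / hbar))"

lemma borel_measurable_mixed_wave [measurable]: "mixed_wave \<alpha> \<beta> d k \<in> borel_measurable borel"
  unfolding mixed_wave_def[abs_def] by measurable

text \<open>By parity the cosine integral sees only the sinc wave and the sine integral only the
  ramp. The latter is exact for \<open>R \<ge> d\<close>, so the whole error is real and consists of
  two defects.\<close>

lemma truncated_fourier_mixed_wave:
  assumes "hbar > 0" "d > 0" "k > 0" "R \<ge> d"
  shows "truncated_fourier hbar R (\<lambda>x. complex_of_real (mixed_wave \<alpha> \<beta> d k x)) p =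
    mixed_transform hbar \<alpha> \<beta> d k p + complex_of_real (1 / sqrt hbar * (\<beta> * (sqrt (1 / (2 * k)) / pi *
      (Si_defect (R * (k + p / hbar)) + Si_defect (R * (k - p / hbar))))))"
proof -
  define q where "q = p / hbar"
  let ?I = "\<lambda>f. LINT x:{- R..R}|lebesgue. f x"
  \<comment> \<open>The function \<open>w\<close> stands for the cosine, the sine or the constant
    1.\<close>
  have sq: "set_integrable lebesgue {- R..R} (\<lambda>x. sinc_wave k x * w x)" if "continuous_on UNIV w" for w
    by (intro absolutely_integrable_continuous_real continuous_intros continuous_on_sinc_wave
        continuous_on_subset[OF that]) auto
  have rq: "set_integrable lebesgue {- R..R} (\<lambda>x. ramp d x * w x)" if "continuous_on UNIV w" for w
  proof -
    have "integrable lebesgue (\<lambda>x. indicator {- d..d} x * (sqrt (3 / (2 * d ^ 3)) * x * w x))"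
      by (intro integrable_continuous_indicator continuous_intros continuous_on_subset[OF that]) auto
    moreover have "(\<lambda>x. indicator {- d..d} x * (sqrt (3 / (2 * d ^ 3)) * x * w x))
        = (\<lambda>x. indicator {- R..R} x *\<^sub>R (ramp d x * w x))"
      using assms(4) by (auto simp: fun_eq_iff ramp_def indicator_def)
    ultimately show ?thesis by (simp add: set_integrable_def)
  qed
  have split: "?I (\<lambda>x. mixed_wave \<alpha> \<beta> d k x * w x)
      = \<alpha> * ?I (\<lambda>x. ramp d x * w x) + \<beta> * ?I (\<lambda>x. sinc_wave k x * w x)"
    if "continuous_on UNIV w" for w
    using set_integral_add(2)[OF set_integrable_mult_right[of \<alpha>, OF rq[OF that]]
        set_integrable_mult_right[of \<beta>, OF sq[OF that]]]
    by (simp add: mixed_wave_def distrib_right mult.assoc)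
  have int: "set_integrable lebesgue {- R..R} (mixed_wave \<alpha> \<beta> d k)"
    unfolding mixed_wave_def[abs_def]
    using rq[of "\<lambda>_. 1"] sq[of "\<lambda>_. 1"] by (auto intro!: set_integral_add)
  have "?I (\<lambda>x. ramp d x * cos (q * x)) = 0"
    by (rule LINT_odd_Icc_eq_0) (simp_all add: ramp_minus)
  then have c: "?I (\<lambda>x. mixed_wave \<alpha> \<beta> d k x * cos (q * x)) = \<beta> * ?I (\<lambda>x. sinc_wave k x * cos (q * x))"
    by (subst split) (auto intro!: continuous_intros)
  have "?I (\<lambda>x. sinc_wave k x * sin (q * x)) = 0"
    by (rule LINT_odd_Icc_eq_0) (simp_all add: sinc_wave_minus)
  then have s: "?I (\<lambda>x. mixed_wave \<alpha> \<beta> d k x * sin (q * x)) = \<alpha> * (sqrt (3 / (2 * d ^ 3)) * ramp_transform d q)"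
    by (subst split) (auto intro!: continuous_intros simp: LINT_ramp_sin[OF assms(4)])
  have "1 / sqrt (2 * pi * hbar) * (\<beta> * J) = 1 / sqrt hbar * (\<beta> * (1 / sqrt (2 * pi) * J))" for J
    by (simp add: real_sqrt_mult)
  note c' = this[of "?I (\<lambda>x. sinc_wave k x * cos (q * x))", folded c,
      unfolded LINT_sinc_wave_cos[OF assms(3) less_le_trans[OF assms(2,4)]]]
  show ?thesis
    unfolding truncated_fourier_of_real[OF borel_measurable_mixed_wave int] q_def[symmetric]
      mixed_transform_def
    using c' by (simp add: complex_eq_iff s distrib_left real_sqrt_mult)
qed

text \<open>The box is in the real part and the ramp transform in the imaginary part, so no cross
  term appears.\<close>

lemma cmod_mixed_transform:
  assumes "hbar > 0" "d > 0"
  shows "(cmod (mixed_transform hbar \<alpha> \<beta> d k p))\<^sup>2 = \<beta>\<^sup>2 * ((sinc_transform k (p / hbar))\<^sup>2 / hbar)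
    + \<alpha>\<^sup>2 * (3 / (2 * d ^ 3)) / (2 * pi) / hbar * (ramp_transform d (p / hbar))\<^sup>2"
proof -
  have "(cmod (complex_of_real (1 / sqrt hbar) * Complex x y))\<^sup>2 = x\<^sup>2 / hbar + y\<^sup>2 / hbar" for x y
    using assms by (simp add: cmod_power2 power_divide)
  then show ?thesis
    using assms by (simp add: mixed_transform_def power_mult_distrib power_divide)
qed

lemma square_integrable_mixed_transform:
  assumes "hbar > 0" "d > 0" "k > 0"
  shows "square_integrable (mixed_transform hbar \<alpha> \<beta> d k)"
proof -
  note [measurable] = integrable_ramp_transform(1)[OF assms(2)]
  have "integrable lborel (\<lambda>p. (sinc_transform k (0 + (1 / hbar) * p))\<^sup>2)"
    "integrable lborel (\<lambda>p. (ramp_transform d (0 + (1 / hbar) * p))\<^sup>2)"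
    using assms integrable_sinc_transform integrable_ramp_transform(2)
    by (intro lborel_integrable_real_affine; simp)+
  then have "integrable lborel (\<lambda>p. (cmod (mixed_transform hbar \<alpha> \<beta> d k p))\<^sup>2)"
    unfolding cmod_mixed_transform[OF assms(1,2)] using assms by simp
  moreover have "mixed_transform hbar \<alpha> \<beta> d k \<in> borel_measurable borel"
    unfolding mixed_transform_def[abs_def] Complex_eq by measurable
  ultimately show ?thesis
    by (auto simp: square_integrable_def integrable_completion measurable_completion)
qed

text \<open>The truncation error is a multiple of two defects whose arguments are affine in p with
  slopes of size R / hbar. Substitution bounds the squared distance by a constant over R.\<close>

lemma is_momentum_wave_mixed_transform:
  assumes "hbar > 0" "d > 0" "k > 0"
  shows "is_momentum_wave hbar (\<lambda>x. complex_of_real (mixed_wave \<alpha> \<beta> d k x)) (mixed_transform hbar \<alpha> \<beta> d k)"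
  unfolding is_momentum_wave_def
proof (intro conjI square_integrable_mixed_transform assms)
  let ?T = "\<lambda>R. truncated_fourier hbar R (\<lambda>x. complex_of_real (mixed_wave \<alpha> \<beta> d k x))"
  let ?I = "\<integral>\<^sup>+ t. ennreal ((Si_defect t)\<^sup>2) \<partial>lborel"
  define L where "L R = (\<integral>\<^sup>+ p. ennreal ((cmod (mixed_transform hbar \<alpha> \<beta> d k p - ?T R p))\<^sup>2) \<partial>lebesgue)" for R
  \<comment> \<open>\<open>M / 2\<close> is the square of the constant in front of the two defects;
    the inequality (x + y)^2 \<le> 2 (x^2 + y^2) turns it into \<open>M\<close>.\<close>
  define M where "M = \<beta>\<^sup>2 / (hbar * k * pi\<^sup>2)"
  obtain r where r: "?I = ennreal r" "r \<ge> 0"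
    using nn_integral_Si_defect by (cases ?I) auto
  have "M \<ge> 0" using assms by (simp add: M_def)
  \<comment> \<open>Each of the two defects contributes \<open>hbar / R * r\<close>, weighted by
    \<open>M\<close>.\<close>
  have L: "L R \<le> ennreal (2 * M * hbar * r / R)" if "R \<ge> d" for R
  proof -
    have R: "R > 0" using that assms by simp
    have "(cmod (mixed_transform hbar \<alpha> \<beta> d k p - ?T R p))\<^sup>2
        \<le> M * ((Si_defect (R * k + R / hbar * p))\<^sup>2 + (Si_defect (R * k + (- R / hbar) * p))\<^sup>2)" for p
    proof -
      let ?x = "Si_defect (R * k + R / hbar * p)" and ?y = "Si_defect (R * k + (- R / hbar) * p)"
      have e: "R * (k + p / hbar) = R * k + R / hbar * p" "R * (k - p / hbar) = R * k + (- R / hbar) * p"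
        by (simp_all add: algebra_simps)
      have "(cmod (mixed_transform hbar \<alpha> \<beta> d k p - ?T R p))\<^sup>2
          = (1 / sqrt hbar * (\<beta> * (sqrt (1 / (2 * k)) / pi * (?x + ?y))))\<^sup>2"
      proof -
        have "(cmod (z - (z + complex_of_real w)))\<^sup>2 = w\<^sup>2" for z w
          by (simp only: norm_minus_commute[of z] add_diff_cancel_left' norm_of_real power2_abs)
        then show ?thesis unfolding truncated_fourier_mixed_wave[OF assms that] e .
      qed
      also have "\<dots> = M / 2 * (?x + ?y)\<^sup>2"
        using assms by (simp add: M_def power_mult_distrib power_divide)
      also have "\<dots> \<le> M / 2 * (2 * (?x\<^sup>2 + ?y\<^sup>2))"
        using sum_squares_bound[of ?x ?y] \<open>M \<ge> 0\<close> by (intro mult_left_mono) (auto simp: power2_sum)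
      also have "\<dots> = M * (?x\<^sup>2 + ?y\<^sup>2)" by simp
      finally show ?thesis .
    qed
    then have "L R \<le> (\<integral>\<^sup>+ p. ennreal M * (ennreal ((Si_defect (R * k + R / hbar * p))\<^sup>2)
        + ennreal ((Si_defect (R * k + (- R / hbar) * p))\<^sup>2)) \<partial>lborel)"
      unfolding L_def nn_integral_completion
      using \<open>M \<ge> 0\<close> by (intro nn_integral_mono) (simp add: ennreal_leI flip: ennreal_plus ennreal_mult)
    also have "\<dots> = ennreal M * (ennreal (hbar / R) * ?I + ennreal (hbar / R) * ?I)"
    proof -
      have "(\<integral>\<^sup>+ p. ennreal ((Si_defect (R * k + R / hbar * p))\<^sup>2) \<partial>lborel) = ennreal (hbar / R) * ?I"
        "(\<integral>\<^sup>+ p. ennreal ((Si_defect (R * k + (- R / hbar) * p))\<^sup>2) \<partial>lborel) = ennreal (hbar / R) * ?I"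
        using R assms nn_integral_Si_defect_affine[of "R / hbar" "R * k"]
          nn_integral_Si_defect_affine[of "- R / hbar" "R * k"] by simp_all
      then show ?thesis
        by (subst nn_integral_cmult, measurable) (subst nn_integral_add, simp_all only:, measurable)
    qed
    also have "\<dots> = ennreal (2 * M * hbar * r / R)"
      using R assms \<open>M \<ge> 0\<close> r by (simp flip: ennreal_plus ennreal_mult)
    finally show ?thesis .
  qed
  have "(L \<longlongrightarrow> 0) at_top"
  proof (rule tendsto_sandwich[of "\<lambda>_. 0"])
    show "\<forall>\<^sub>F R in at_top. L R \<le> ennreal (2 * M * hbar * r / R)"
      using eventually_ge_at_top[of d] by eventually_elim (rule L)
    show "((\<lambda>R. ennreal (2 * M * hbar * r / R)) \<longlongrightarrow> 0) at_top"
      using tendsto_ennrealI[OF const_over_at_top] by simp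
  qed auto
  then show "((\<lambda>R. \<integral>\<^sup>+ p. ennreal ((cmod (mixed_transform hbar \<alpha> \<beta> d k p - ?T R p))\<^sup>2) \<partial>lebesgue) \<longlongrightarrow> 0) at_top"
    unfolding L_def .
qed


section \<open>Masses on the two short intervals\<close>

text \<open>The product of ramp and sinc wave is odd, so the cross term vanishes over the line and
  over [-d, d]. On [-d, d] the ramp has its full mass and the sinc wave adds a nonnegative
  amount.\<close>

lemma pure_state_mixed_wave:
  assumes "d > 0" "k > 0" and "\<alpha>\<^sup>2 + \<beta>\<^sup>2 = 1"
  shows "pure_state (\<lambda>x. complex_of_real (mixed_wave \<alpha> \<beta> d k x))"
    and "(LINT x:{- d..d}|lebesgue. (cmod (complex_of_real (mixed_wave \<alpha> \<beta> d k x)))\<^sup>2) \<ge> \<alpha>\<^sup>2"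
proof -
  let ?f = "ramp d" and ?g = "sinc_wave k"
  note i = ramp_squared(1)[OF assms(1)] sinc_wave_squared(1)[OF assms(2)] integrable_ramp_mult_sinc_wave[of d k]
  have e: "(cmod (complex_of_real (mixed_wave \<alpha> \<beta> d k x)))\<^sup>2
      = \<alpha>\<^sup>2 * (?f x)\<^sup>2 + \<beta>\<^sup>2 * (?g x)\<^sup>2 + 2 * \<alpha> * \<beta> * (?f x * ?g x)" for x
    by (simp only: norm_of_real power2_abs mixed_wave_def) (simp add: power2_eq_square algebra_simps)
  have int: "integrable lebesgue (\<lambda>x. \<alpha>\<^sup>2 * (?f x)\<^sup>2 + \<beta>\<^sup>2 * (?g x)\<^sup>2 + 2 * \<alpha> * \<beta> * (?f x * ?g x))"
    using i by (intro Bochner_Integration.integrable_add integrable_mult_right)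
  have cross: "(\<integral>x. ?f x * ?g x \<partial>lebesgue) = 0"
    by (rule integral_odd_eq_0) (simp_all add: ramp_minus sinc_wave_minus)
  have "(\<integral>x. \<alpha>\<^sup>2 * (?f x)\<^sup>2 + \<beta>\<^sup>2 * (?g x)\<^sup>2 + 2 * \<alpha> * \<beta> * (?f x * ?g x) \<partial>lebesgue)
      = \<alpha>\<^sup>2 * (\<integral>x. (?f x)\<^sup>2 \<partial>lebesgue) + \<beta>\<^sup>2 * (\<integral>x. (?g x)\<^sup>2 \<partial>lebesgue)
        + 2 * \<alpha> * \<beta> * (\<integral>x. ?f x * ?g x \<partial>lebesgue)"
    using i by simp
  then have "(LINT x|lebesgue. (cmod (complex_of_real (mixed_wave \<alpha> \<beta> d k x)))\<^sup>2) = 1"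
    unfolding e cross ramp_squared(2)[OF assms(1)] sinc_wave_squared(2)[OF assms(2)] using assms(3) by simp
  then show "pure_state (\<lambda>x. complex_of_real (mixed_wave \<alpha> \<beta> d k x))"
    using int unfolding pure_state_def square_integrable_def e by (auto intro!: measurable_completion)
  have si: "set_integrable lebesgue {- d..d} h" if "integrable lebesgue h" for h :: "real \<Rightarrow> real"
    using integrable_mult_indicator[OF _ that, of "{- d..d}"] by (simp add: set_integrable_def)
  have "(LINT x:{- d..d}|lebesgue. ?f x * ?g x) = 0"
    by (rule LINT_odd_Icc_eq_0) (simp_all add: ramp_minus sinc_wave_minus)
  moreover have "(LINT x:{- d..d}|lebesgue. (?g x)\<^sup>2) \<ge> 0"
    by (simp add: set_lebesgue_integral_def)
  moreover have "(LINT x:{- d..d}|lebesgue. (cmod (complex_of_real (mixed_wave \<alpha> \<beta> d k x)))\<^sup>2)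
      = \<alpha>\<^sup>2 * (LINT x:{- d..d}|lebesgue. (?f x)\<^sup>2) + \<beta>\<^sup>2 * (LINT x:{- d..d}|lebesgue. (?g x)\<^sup>2)
        + 2 * \<alpha> * \<beta> * (LINT x:{- d..d}|lebesgue. ?f x * ?g x)"
    unfolding e using i
    by (simp only: set_integral_add(2) set_integral_add(1) si integrable_mult_right set_integrable_mult_right
        Bochner_Integration.integrable_add set_integral_mult_right)
  ultimately show "(LINT x:{- d..d}|lebesgue. (cmod (complex_of_real (mixed_wave \<alpha> \<beta> d k x)))\<^sup>2) \<ge> \<alpha>\<^sup>2"
    by (simp add: ramp_squared(3)[OF assms(1)])
qed

lemma LINT_mixed_transform:
  assumes "hbar > 0" "d > 0" "k > 0"
  shows "(LINT p:{- (hbar * k)<..<hbar * k}|lebesgue. (cmod (mixed_transform hbar \<alpha> \<beta> d k p))\<^sup>2) \<ge> \<beta>\<^sup>2"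
proof -
  let ?Y = "{- (hbar * k)<..<hbar * k}"
  have "\<beta>\<^sup>2 = \<beta>\<^sup>2 * (LINT p:?Y|lebesgue. (sinc_transform k (p / hbar))\<^sup>2 / hbar)"
    using assms by (simp only: LINT_sinc_transform mult_1_right)
  also have "\<dots> = (LINT p:?Y|lebesgue. \<beta>\<^sup>2 * ((sinc_transform k (p / hbar))\<^sup>2 / hbar))"
    by (simp only: set_integral_mult_right)
  also have "\<dots> \<le> (LINT p:?Y|lebesgue. (cmod (mixed_transform hbar \<alpha> \<beta> d k p))\<^sup>2)"
    unfolding set_lebesgue_integral_def
  proof (rule integral_mono')
    show "integrable lebesgue (\<lambda>p. indicat_real ?Y p *\<^sub>R (cmod (mixed_transform hbar \<alpha> \<beta> d k p))\<^sup>2)"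
      using square_integrable_mixed_transform[OF assms, of \<alpha> \<beta>]
      by (intro integrable_mult_indicator) (auto simp: square_integrable_def)
  next
    fix p :: real
    show "indicat_real ?Y p *\<^sub>R (\<beta>\<^sup>2 * ((sinc_transform k (p / hbar))\<^sup>2 / hbar))
        \<le> indicat_real ?Y p *\<^sub>R (cmod (mixed_transform hbar \<alpha> \<beta> d k p))\<^sup>2"
      unfolding cmod_mixed_transform[OF assms(1,2)] using assms
      by (intro scaleR_left_mono) auto
  qed (use assms in \<open>auto simp: indicator_def\<close>)
  finally show ?thesis .
qed

section \<open>Confidence widths and the conclusion\<close>

lemma confidence_width_le:
  assumes "X \<in> sets lebesgue" and "(LINT x:X|lebesgue. (cmod (f x))\<^sup>2) \<ge> \<theta>"
  shows "confidence_width \<theta> f \<le> emeasure lebesgue X"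
  unfolding confidence_width_def using assms by (intro Inf_lower CollectI exI[of _ X] conjI refl)

text \<open>\<open>momentum_wave\<close> is an arbitrary choice by \<open>SOME\<close>. An explicit
  \<phi> may replace it because the two agree almost everywhere and confidence widths ignore null
  sets.\<close>

lemma momentum_uncertainty_eq:
  assumes "\<psi> \<in> borel_measurable lebesgue" and "is_momentum_wave hbar \<psi> \<phi>"
  shows "momentum_uncertainty hbar \<theta> \<psi> = confidence_width \<theta> \<phi>"
proof -
  have "is_momentum_wave hbar \<psi> (momentum_wave hbar \<psi>)"
    using someI[of "is_momentum_wave hbar \<psi>", OF assms(2)] by (simp add: momentum_wave_def)
  with assms show ?thesis
    unfolding momentum_uncertainty_def
    by (intro confidence_width_cong_AE is_momentum_wave_AE_unique[of \<psi> hbar])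
       (auto simp: is_momentum_wave_def)
qed

lemma exists_state_uncertainties_less:
  assumes "hbar > 0" and "\<theta>\<^sub>x \<in> {0..1}" and "\<theta>\<^sub>x + \<theta>\<^sub>p \<le> 1" and "\<epsilon> > 0"
  shows "\<exists>\<psi>. pure_state \<psi> \<and> position_uncertainty \<theta>\<^sub>x \<psi> < ennreal \<epsilon>
    \<and> momentum_uncertainty hbar \<theta>\<^sub>p \<psi> < ennreal \<epsilon>"
proof -
  \<comment> \<open>Both d and hbar k equal \<epsilon>/4, so the position and the momentum interval
    each have length \<epsilon>/2. The weights give mass at least \<open>\<theta>\<^sub>x\<close> to
    the first and at least \<open>1 - \<theta>\<^sub>x\<close>, hence
    \<open>\<theta>\<^sub>p\<close>, to the second.\<close>
  define \<alpha> \<beta> d k where "\<alpha> = sqrt \<theta>\<^sub>x" and "\<beta> = sqrt (1 - \<theta>\<^sub>x)" and "d = \<epsilon> / 4" and "k = \<epsilon> / (4 * hbar)"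
  define \<psi> where "\<psi> = (\<lambda>x. complex_of_real (mixed_wave \<alpha> \<beta> d k x))"
  have pos: "d > 0" "k > 0" and \<alpha>\<beta>: "\<alpha>\<^sup>2 = \<theta>\<^sub>x" "\<beta>\<^sup>2 = 1 - \<theta>\<^sub>x"
    using assms by (auto simp: \<alpha>_def \<beta>_def d_def k_def)
  then have state: "pure_state \<psi>" and x: "(LINT x:{- d..d}|lebesgue. (cmod (\<psi> x))\<^sup>2) \<ge> \<theta>\<^sub>x"
    using pure_state_mixed_wave[of d k \<alpha> \<beta>] by (auto simp: \<psi>_def)
  have "position_uncertainty \<theta>\<^sub>x \<psi> \<le> emeasure lebesgue {- d..d}"
    unfolding position_uncertainty_def by (rule confidence_width_le[OF _ x]) simp
  also have "\<dots> < ennreal \<epsilon>"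
    using assms(4) by (simp add: d_def ennreal_lessI)
  finally have px: "position_uncertainty \<theta>\<^sub>x \<psi> < ennreal \<epsilon>" .
  have p: "(LINT p:{- (hbar * k)<..<hbar * k}|lebesgue. (cmod (mixed_transform hbar \<alpha> \<beta> d k p))\<^sup>2) \<ge> \<theta>\<^sub>p"
    using LINT_mixed_transform[OF assms(1) pos, of \<beta> \<alpha>] assms(3) \<alpha>\<beta> by simp
  have "momentum_uncertainty hbar \<theta>\<^sub>p \<psi> = confidence_width \<theta>\<^sub>p (mixed_transform hbar \<alpha> \<beta> d k)"
    using is_momentum_wave_mixed_transform[OF assms(1) pos, of \<alpha> \<beta>] state
    by (intro momentum_uncertainty_eq) (auto simp: \<psi>_def pure_state_def square_integrable_def)
  also have "\<dots> \<le> emeasure lebesgue {- (hbar * k)<..<hbar * k}"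
    by (rule confidence_width_le[OF _ p]) simp
  also have "\<dots> < ennreal \<epsilon>"
    using assms(1,4) by (simp add: k_def ennreal_lessI)
  finally show ?thesis using state px by blast
qed

lemma uncertainty_constants_trivial:
  assumes "hbar > 0" and "\<theta>\<^sub>x \<in> {0..1}" and "\<theta>\<^sub>x + \<theta>\<^sub>p \<le> 1" and "g \<in> uncertainty_constants hbar \<theta>\<^sub>x \<theta>\<^sub>p"
  shows "g \<le> 0"
proof (rule ccontr)
  assume "\<not> g \<le> 0"
  then have g: "g * hbar > 0" using assms(1) by simp
  \<comment> \<open>With this bound on both widths their product is at most g hbar / 2, which is
    below g hbar.\<close>
  obtain \<psi> where \<psi>: "pure_state \<psi>" "position_uncertainty \<theta>\<^sub>x \<psi> < ennreal (sqrt (g * hbar / 2))"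
      "momentum_uncertainty hbar \<theta>\<^sub>p \<psi> < ennreal (sqrt (g * hbar / 2))"
    using exists_state_uncertainties_less[OF assms(1-3), of "sqrt (g * hbar / 2)"] g by auto
  have "ennreal (g * hbar) \<le> position_uncertainty \<theta>\<^sub>x \<psi> * momentum_uncertainty hbar \<theta>\<^sub>p \<psi>"
    using assms(4) \<psi>(1) by (simp add: uncertainty_constants_def)
  also have "\<dots> \<le> ennreal (sqrt (g * hbar / 2)) * ennreal (sqrt (g * hbar / 2))"
    using \<psi>(2,3) by (intro mult_mono) auto
  also have "\<dots> = ennreal (g * hbar / 2)"
    using g by (simp flip: ennreal_mult)
  finally show False using g by simp
qed

theorem theorem1:
  fixes hbar :: real
  assumes "hbar > 0"
  shows "(\<forall>\<theta>\<^sub>x \<in> {0..1}. \<forall>\<theta>\<^sub>p \<in> {0..1}. \<theta>\<^sub>x + \<theta>\<^sub>p \<le> 1 \<longrightarrow>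
        (\<forall>\<epsilon>::real. \<epsilon> > 0 \<longrightarrow> (\<exists>\<psi>. pure_state \<psi> \<and>
            position_uncertainty \<theta>\<^sub>x \<psi> < ennreal \<epsilon> \<and> momentum_uncertainty hbar \<theta>\<^sub>p \<psi> < ennreal \<epsilon>))
        \<and> (0 \<in> uncertainty_constants hbar \<theta>\<^sub>x \<theta>\<^sub>p \<and> (\<forall>g \<in> uncertainty_constants hbar \<theta>\<^sub>x \<theta>\<^sub>p. g \<le> 0)))
    \<and> (\<forall>\<epsilon>::real. \<epsilon> > 0 \<longrightarrow> (\<exists>\<psi>. pure_state \<psi> \<and>
            position_uncertainty (1/2) \<psi> < ennreal \<epsilon> \<and> momentum_uncertainty hbar (1/2) \<psi> < ennreal \<epsilon>))
    \<and> (0 \<in> uncertainty_constants hbar (1/2) (1/2) \<and> (\<forall>g \<in> uncertainty_constants hbar (1/2) (1/2). g \<le> 0))"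
proof -
  have zero: "0 \<in> uncertainty_constants hbar \<theta>\<^sub>x \<theta>\<^sub>p" for \<theta>\<^sub>x \<theta>\<^sub>p
    by (simp add: uncertainty_constants_def)
  have "(1 / 2 :: real) \<in> {0..1}" "1 / 2 + 1 / 2 \<le> (1 :: real)" by simp_all
  note half = exists_state_uncertainties_less[OF assms this] uncertainty_constants_trivial[OF assms this]
  show ?thesis
    using zero half exists_state_uncertainties_less[OF assms] uncertainty_constants_trivial[OF assms]
    by blast
qed

end
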